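(* Let $n\ge 2$ be a positive integer, $K$ a field and $R_n$ the rose with $n$ petals. Then, for any $p \in A_{R_n}(e_1, e_2)$, there exists a unique automorphism $\sigma_p$ of the $K$-algebra $L_K(R_n)$ satisfying $$\sigma_p(e_2) = e_2 + e_1p,\quad \sigma_p(e^*_1) = e^*_1 - pe^*_2,\quad \sigma^{-1}_p(e_2) = e_2 - e_1p,\quad \sigma^{-1}_p(e^*_1) = e^*_1 + pe^*_2$$ and $\sigma_p(q) = q$ for all $q\in A_{R_n}(e_1, e_2)$.
   Context: $R_n$ is the directed graph with one vertex $v$ and $n$ loops $e_1,\ldots,e_n$. Its Leavitt path algebra $L_K(R_n)$ is the unital associative $K$-algebra generated by $v,e_1,\ldots,e_n,e_1^*,\ldots,e_n^*$ subject to $v=1$ (i.e. $v^2=v$, $ve_i=e_i=e_iv$, $ve_i^*=e_i^*=e_i^*v$), $e_i^*e_j=\delta_{i,j}v$ for all $1\le i,j\le n$, and $\sum_{i=1}^n e_ie_i^*=v$. $A_{R_n}(e_1,e_2)$ denotes the $K$-subalgebra of $L_K(R_n)$ generated by $v,e_1,e_3,\ldots,e_n,e_2^*,\ldots,e_n^*$ (all $e_i$ except $e_2$, all $e_i^*$ except $e_1^*$). *)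

theory Defs
  imports "HOL-Algebra.QuotRing" "HOL-Algebra.Subrings" "HOL-Algebra.Bij"
begin

text \<open>The free unital associative \<open>K\<close>-algebra on a set \<open>X\<close> of generators, as the
  monoid algebra of the words over \<open>X\<close>: an element maps each word to its coefficient, and
  \<^term>\<open>(take i w, drop i w)\<close> runs through all factorisations of the word \<open>w\<close>.\<close>

definition free_algebra ::
    "('k, 'm) ring_scheme \<Rightarrow> 'x set \<Rightarrow> ('k, 'x list \<Rightarrow> 'k) module"
  where "free_algebra K X =
    \<lparr>carrier = {f. (\<forall>w. f w \<in> carrier K) \<and> finite {w. f w \<noteq> \<zero>\<^bsub>K\<^esub>}
                  \<and> (\<forall>w. f w \<noteq> \<zero>\<^bsub>K\<^esub> \<longrightarrow> w \<in> lists X)},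
     mult = (\<lambda>f g w. \<Oplus>\<^bsub>K\<^esub>i\<in>{..length w}. f (take i w) \<otimes>\<^bsub>K\<^esub> g (drop i w)),
     one = (\<lambda>w. if w = [] then \<one>\<^bsub>K\<^esub> else \<zero>\<^bsub>K\<^esub>),
     zero = (\<lambda>w. \<zero>\<^bsub>K\<^esub>),
     add = (\<lambda>f g w. f w \<oplus>\<^bsub>K\<^esub> g w),
     smult = (\<lambda>a f w. a \<otimes>\<^bsub>K\<^esub> f w)\<rparr>"

definition letter :: "('k, 'm) ring_scheme \<Rightarrow> 'x \<Rightarrow> 'x list \<Rightarrow> 'k"
  where "letter K x = (\<lambda>w. if w = [x] then \<one>\<^bsub>K\<^esub> else \<zero>\<^bsub>K\<^esub>)"

text \<open>The quotient of an algebra by a two-sided ideal: the quotient ring \<^term>\<open>F Quot I\<close>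
  together with the induced scalar multiplication on cosets.\<close>

definition quot_algebra ::
    "('k, 'a, 'm) module_scheme \<Rightarrow> 'a set \<Rightarrow> ('k, 'a set) module"
  where "quot_algebra F I =
    ring.extend (F Quot I) (module.fields (\<lambda>a A. \<Union>f\<in>A. I +>\<^bsub>F\<^esub> (a \<odot>\<^bsub>F\<^esub> f)))"

text \<open>\<^term>\<open>Ghost i\<close> stands for the generator \<open>e\<^sub>i\<^sup>*\<close>.\<close>

datatype rose_gen = Vertex | Edge nat | Ghost nat

definition rose_gens :: "nat \<Rightarrow> rose_gen set"
  where "rose_gens n = {Vertex} \<union> Edge ` {1..n} \<union> Ghost ` {1..n}"

definition rose_free :: "('k, 'm) ring_scheme \<Rightarrow> nat \<Rightarrow> ('k, rose_gen list \<Rightarrow> 'k) module"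
  where "rose_free K n = free_algebra K (rose_gens n)"

text \<open>A relation \<open>l = r\<close> is represented by the element \<open>l - r\<close> of the free algebra.\<close>

definition rose_relations :: "('k, 'm) ring_scheme \<Rightarrow> nat \<Rightarrow> (rose_gen list \<Rightarrow> 'k) set"
  where "rose_relations K n =
    (let F = rose_free K n; v = letter K Vertex;
         e = (\<lambda>i. letter K (Edge i)); e' = (\<lambda>i. letter K (Ghost i))
     in {v \<ominus>\<^bsub>F\<^esub> \<one>\<^bsub>F\<^esub>, v \<otimes>\<^bsub>F\<^esub> v \<ominus>\<^bsub>F\<^esub> v}
        \<union> (\<Union>i\<in>{1..n}. {v \<otimes>\<^bsub>F\<^esub> e i \<ominus>\<^bsub>F\<^esub> e i, e i \<otimes>\<^bsub>F\<^esub> v \<ominus>\<^bsub>F\<^esub> e i,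
                         v \<otimes>\<^bsub>F\<^esub> e' i \<ominus>\<^bsub>F\<^esub> e' i, e' i \<otimes>\<^bsub>F\<^esub> v \<ominus>\<^bsub>F\<^esub> e' i})
        \<union> (\<Union>i\<in>{1..n}. \<Union>j\<in>{1..n}.
             {e' i \<otimes>\<^bsub>F\<^esub> e j \<ominus>\<^bsub>F\<^esub> (if i = j then v else \<zero>\<^bsub>F\<^esub>)})
        \<union> {(\<Oplus>\<^bsub>F\<^esub>i\<in>{1..n}. e i \<otimes>\<^bsub>F\<^esub> e' i) \<ominus>\<^bsub>F\<^esub> v})"

definition rose_ideal :: "('k, 'm) ring_scheme \<Rightarrow> nat \<Rightarrow> (rose_gen list \<Rightarrow> 'k) set"
  where "rose_ideal K n = Idl\<^bsub>rose_free K n\<^esub> (rose_relations K n)"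

text \<open>The Leavitt path algebra of the rose with \<open>n\<close> petals, and the images of the generators
  in it.\<close>

definition rose_LPA ::
    "('k, 'm) ring_scheme \<Rightarrow> nat \<Rightarrow> ('k, (rose_gen list \<Rightarrow> 'k) set) module"
  where "rose_LPA K n = quot_algebra (rose_free K n) (rose_ideal K n)"

definition rose_elem ::
    "('k, 'm) ring_scheme \<Rightarrow> nat \<Rightarrow> rose_gen \<Rightarrow> (rose_gen list \<Rightarrow> 'k) set"
  where "rose_elem K n x = rose_ideal K n +>\<^bsub>rose_free K n\<^esub> letter K x"

definition subalgebra_generated ::
    "('k, 'm) ring_scheme \<Rightarrow> ('k, 'a, 'c) module_scheme \<Rightarrow> 'a set \<Rightarrow> 'a set"
  where "subalgebra_generated K L S = \<Inter>{B. subring B L \<and> submodule B K L \<and> S \<subseteq> B}"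

text \<open>\<open>A(e\<^sub>s, e\<^sub>t)\<close>: note that \<open>s\<close> excludes a ghost edge and \<open>t\<close> an edge.\<close>

definition rose_subalgebra ::
    "('k, 'm) ring_scheme \<Rightarrow> nat \<Rightarrow> nat \<Rightarrow> nat \<Rightarrow> (rose_gen list \<Rightarrow> 'k) set set"
  where "rose_subalgebra K n s t =
    subalgebra_generated K (rose_LPA K n)
      (rose_elem K n ` ({Vertex} \<union> Edge ` ({1..n} - {t}) \<union> Ghost ` ({1..n} - {s})))"

text \<open>As for \<^const>\<open>auto\<close>, automorphisms are extensional functions on the carrier, so that
  two of them are equal as soon as they agree on the carrier.\<close>

definition algebra_auto ::
    "('k, 'm) ring_scheme \<Rightarrow> ('k, 'a, 'c) module_scheme \<Rightarrow> ('a \<Rightarrow> 'a) set"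
  where "algebra_auto K L =
    {h \<in> ring_hom L L \<inter> Bij (carrier L).
       \<forall>a\<in>carrier K. \<forall>x\<in>carrier L. h (a \<odot>\<^bsub>L\<^esub> x) = a \<odot>\<^bsub>L\<^esub> h x}"

end

theory Submission
  imports Defs
begin

text \<open>For every \<open>p\<close> in the Leavitt path algebra, the elements \<open>e\<^sub>1, e\<^sub>2 + e\<^sub>1p, e\<^sub>3, \<dots>, e\<^sub>n\<close> and
  \<open>e\<^sub>1\<^sup>* - pe\<^sub>2\<^sup>*, e\<^sub>2\<^sup>*, \<dots>, e\<^sub>n\<^sup>*\<close> again satisfy the defining relations, so by the universal property
  they are the images of the generators under an endomorphism \<open>\<sigma>\<^sub>p\<close>, which fixes the generators of
  \<open>A(e\<^sub>1, e\<^sub>2)\<close> and hence all of \<open>A(e\<^sub>1, e\<^sub>2)\<close>. Only if \<open>p \<in> A(e\<^sub>1, e\<^sub>2)\<close> is \<open>p\<close> itself known to be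
  fixed, and then \<open>\<sigma>\<^sub>p\<close> and \<open>\<sigma>\<^sub>-\<^sub>p\<close> are inverse to each other on generators. Uniqueness holds because
  \<open>A(e\<^sub>1, e\<^sub>2)\<close>, \<open>e\<^sub>2\<close> and \<open>e\<^sub>1\<^sup>*\<close> generate the algebra.\<close>

section \<open>Associative algebras\<close>

text \<open>Unlike the locale \<open>algebra\<close> of the library, \<open>assoc_algebra\<close> does not ask the multiplication
  to be commutative.\<close>

locale assoc_algebra = module + M?: ring M +
  assumes smult_assoc2:
      "\<lbrakk>a \<in> carrier R; x \<in> carrier M; y \<in> carrier M\<rbrakk> \<Longrightarrow>
      (a \<odot>\<^bsub>M\<^esub> x) \<otimes>\<^bsub>M\<^esub> y = a \<odot>\<^bsub>M\<^esub> (x \<otimes>\<^bsub>M\<^esub> y)"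
    and smult_assoc3:
      "\<lbrakk>a \<in> carrier R; x \<in> carrier M; y \<in> carrier M\<rbrakk> \<Longrightarrow>
      x \<otimes>\<^bsub>M\<^esub> (a \<odot>\<^bsub>M\<^esub> y) = a \<odot>\<^bsub>M\<^esub> (x \<otimes>\<^bsub>M\<^esub> y)"

definition algebra_hom ::
    "('k, 'm) ring_scheme \<Rightarrow> ('k, 'a, 'c) module_scheme \<Rightarrow> ('k, 'b, 'd) module_scheme \<Rightarrow> ('a \<Rightarrow> 'b) set"
  where "algebra_hom K M N =
    {h \<in> ring_hom M N. \<forall>a\<in>carrier K. \<forall>x\<in>carrier M. h (a \<odot>\<^bsub>M\<^esub> x) = a \<odot>\<^bsub>N\<^esub> h x}"

lemma algebra_hom_closed: "\<lbrakk>h \<in> algebra_hom K M N; x \<in> carrier M\<rbrakk> \<Longrightarrow> h x \<in> carrier N"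
  and algebra_hom_add: "\<lbrakk>h \<in> algebra_hom K M N; x \<in> carrier M; y \<in> carrier M\<rbrakk>
      \<Longrightarrow> h (x \<oplus>\<^bsub>M\<^esub> y) = h x \<oplus>\<^bsub>N\<^esub> h y"
  and algebra_hom_mult: "\<lbrakk>h \<in> algebra_hom K M N; x \<in> carrier M; y \<in> carrier M\<rbrakk>
      \<Longrightarrow> h (x \<otimes>\<^bsub>M\<^esub> y) = h x \<otimes>\<^bsub>N\<^esub> h y"
  and algebra_hom_one: "h \<in> algebra_hom K M N \<Longrightarrow> h \<one>\<^bsub>M\<^esub> = \<one>\<^bsub>N\<^esub>"
  and algebra_hom_smult: "\<lbrakk>h \<in> algebra_hom K M N; a \<in> carrier K; x \<in> carrier M\<rbrakk>
      \<Longrightarrow> h (a \<odot>\<^bsub>M\<^esub> x) = a \<odot>\<^bsub>N\<^esub> h x"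
  by (auto simp: algebra_hom_def ring_hom_def)

lemma algebra_hom_ring_hom_ring:
  assumes "assoc_algebra K M" "assoc_algebra K N" "h \<in> algebra_hom K M N"
  shows "ring_hom_ring M N h"
  using assms by (simp add: ring_hom_ringI2 assoc_algebra.axioms algebra_hom_def)

lemma algebra_hom_comp:
  assumes "g \<in> algebra_hom K N P" "h \<in> algebra_hom K M N"
  shows "g \<circ> h \<in> algebra_hom K M P"
  using assms by (auto simp: algebra_hom_def ring_hom_closed intro: ring_hom_trans)

lemma algebra_hom_id: "(\<lambda>x. x) \<in> algebra_hom K M M"
  by (simp add: algebra_hom_def ring_hom_def)

text \<open>The equaliser of \<open>g\<close> and \<open>h\<close> is both a subring and a
  submodule. Once it contains \<open>S\<close>, it is one of the sets intersected in
  \<open>subalgebra_generated\<close>.\<close>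

lemma algebra_hom_eq_on_generated:
  assumes "assoc_algebra K M" "assoc_algebra K N"
    and g: "g \<in> algebra_hom K M N" and h: "h \<in> algebra_hom K M N"
    and S: "S \<subseteq> carrier M" "\<And>s. s \<in> S \<Longrightarrow> g s = h s"
    and x: "x \<in> subalgebra_generated K M S"
  shows "g x = h x"
proof -
  interpret M: assoc_algebra K M by fact
  interpret N: assoc_algebra K N by fact
  interpret g: ring_hom_ring M N g by (rule algebra_hom_ring_hom_ring) fact+
  interpret h: ring_hom_ring M N h by (rule algebra_hom_ring_hom_ring) fact+
  let ?B = "{x \<in> carrier M. g x = h x}"
  have "subring ?B M"
    by (rule M.subringI) auto
  moreover have "submodule ?B K M"
    by (rule M.submoduleI) (auto simp: algebra_hom_smult[OF g] algebra_hom_smult[OF h])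
  ultimately show ?thesis
    using S x by (auto simp: subalgebra_generated_def)
qed

section \<open>The free algebra and its universal property\<close>

text \<open>Monomials. The letters and the unit of the free algebra are monomials with coefficient
  one, so multilinear identities need to be checked on monomials only.\<close>

definition word_term :: "('k, 'm) ring_scheme \<Rightarrow> 'k \<Rightarrow> 'x list \<Rightarrow> 'x list \<Rightarrow> 'k"
  where "word_term K a w = (\<lambda>u. if u = w then a else \<zero>\<^bsub>K\<^esub>)"

lemma letter_eq_word_term: "letter K x = word_term K \<one>\<^bsub>K\<^esub> [x]"
  by (simp add: letter_def word_term_def)

context cring
begin

lemma free_algebra_simps:
  "\<zero>\<^bsub>free_algebra R X\<^esub> = (\<lambda>w. \<zero>)"
  "\<one>\<^bsub>free_algebra R X\<^esub> = word_term R \<one> []"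
  "f \<oplus>\<^bsub>free_algebra R X\<^esub> g = (\<lambda>w. f w \<oplus> g w)"
  "a \<odot>\<^bsub>free_algebra R X\<^esub> f = (\<lambda>w. a \<otimes> f w)"
  "f \<otimes>\<^bsub>free_algebra R X\<^esub> g = (\<lambda>w. \<Oplus>i\<in>{..length w}. f (take i w) \<otimes> g (drop i w))"
  by (simp_all add: free_algebra_def word_term_def)

lemma free_algebra_carrier:
  "f \<in> carrier (free_algebra R X) \<longleftrightarrow>
    (\<forall>w. f w \<in> carrier R) \<and> finite {w. f w \<noteq> \<zero>} \<and> {w. f w \<noteq> \<zero>} \<subseteq> lists X"
  by (auto simp: free_algebra_def)

lemma free_algebra_coeff_closed: "f \<in> carrier (free_algebra R X) \<Longrightarrow> f w \<in> carrier R"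
  by (simp add: free_algebra_carrier)

text \<open>The set \<open>S\<close> may be larger than the support. This spares the closure proofs
  from determining which coefficients cancel.\<close>

lemma free_algebra_carrierI:
  assumes "\<And>w. f w \<in> carrier R" "finite S" "S \<subseteq> lists X" "\<And>w. w \<notin> S \<Longrightarrow> f w = \<zero>"
  shows "f \<in> carrier (free_algebra R X)"
proof -
  have "{w. f w \<noteq> \<zero>} \<subseteq> S"
    using assms(4) by blast
  then show ?thesis
    using assms by (auto simp: free_algebra_carrier intro: finite_subset)
qed

lemma word_term_closed:
  "\<lbrakk>a \<in> carrier R; w \<in> lists X\<rbrakk> \<Longrightarrow> word_term R a w \<in> carrier (free_algebra R X)"
  by (rule free_algebra_carrierI[of _ "{w}"]) (auto simp: word_term_def)

lemma free_algebra_one_closed: "\<one>\<^bsub>free_algebra R X\<^esub> \<in> carrier (free_algebra R X)"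
  by (simp add: free_algebra_simps(2) word_term_closed)

lemma free_algebra_mult_closed:
  assumes f: "f \<in> carrier (free_algebra R X)" and g: "g \<in> carrier (free_algebra R X)"
  shows "f \<otimes>\<^bsub>free_algebra R X\<^esub> g \<in> carrier (free_algebra R X)"
proof (rule free_algebra_carrierI)
  \<comment> \<open>A word with nonzero coefficient in the product is a concatenation of two words
    from the supports of \<open>f\<close> and \<open>g\<close>.\<close>
  let ?S = "(\<lambda>(u, v). u @ v) ` ({w. f w \<noteq> \<zero>} \<times> {w. g w \<noteq> \<zero>})"
  show "finite ?S" "?S \<subseteq> lists X"
    using f g unfolding free_algebra_carrier by fastforce+
  show "(f \<otimes>\<^bsub>free_algebra R X\<^esub> g) w \<in> carrier R" for w
    using f g by (auto simp: free_algebra_simps free_algebra_carrier intro!: finsum_closed)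
  show "(f \<otimes>\<^bsub>free_algebra R X\<^esub> g) w = \<zero>" if "w \<notin> ?S" for w
  proof -
    have "f (take i w) = \<zero> \<or> g (drop i w) = \<zero>" for i
      using that by (force simp: image_iff)
    then have "f (take i w) \<otimes> g (drop i w) = \<zero>" for i
      using f g by (metis free_algebra_coeff_closed l_null r_null)
    then show ?thesis
      by (simp add: free_algebra_simps)
  qed
qed

lemma free_algebra_abelian_group: "abelian_group (free_algebra R X)"
proof (rule abelian_groupI)
  fix f g
  assume fg: "f \<in> carrier (free_algebra R X)" "g \<in> carrier (free_algebra R X)"
  then show "f \<oplus>\<^bsub>free_algebra R X\<^esub> g \<in> carrier (free_algebra R X)"
    by (intro free_algebra_carrierI[of _ "{w. f w \<noteq> \<zero>} \<union> {w. g w \<noteq> \<zero>}"])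
       (auto simp: free_algebra_simps free_algebra_carrier)
  show "\<exists>g\<in>carrier (free_algebra R X). g \<oplus>\<^bsub>free_algebra R X\<^esub> f = \<zero>\<^bsub>free_algebra R X\<^esub>"
    using fg(1)
    by (intro bexI[of _ "\<lambda>w. \<ominus> f w"] free_algebra_carrierI[of _ "{w. f w \<noteq> \<zero>}"])
       (auto simp: free_algebra_simps free_algebra_carrier l_neg)
qed (auto simp: free_algebra_simps free_algebra_carrier a_ac)

lemma free_algebra_module: "module R (free_algebra R X)"
proof (rule moduleI)
  fix a f
  assume "a \<in> carrier R" "f \<in> carrier (free_algebra R X)"
  then show "a \<odot>\<^bsub>free_algebra R X\<^esub> f \<in> carrier (free_algebra R X)"
    by (intro free_algebra_carrierI[of _ "{w. f w \<noteq> \<zero>}"])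
       (auto simp: free_algebra_simps free_algebra_carrier)
qed (auto simp: free_algebra_simps free_algebra_coeff_closed l_distr r_distr m_assoc
      free_algebra_abelian_group is_cring)

lemma free_algebra_distr:
  assumes "f \<in> carrier (free_algebra R X)" "g \<in> carrier (free_algebra R X)"
    "h \<in> carrier (free_algebra R X)"
  shows "(f \<oplus>\<^bsub>free_algebra R X\<^esub> g) \<otimes>\<^bsub>free_algebra R X\<^esub> h
      = f \<otimes>\<^bsub>free_algebra R X\<^esub> h \<oplus>\<^bsub>free_algebra R X\<^esub> g \<otimes>\<^bsub>free_algebra R X\<^esub> h"
    and "h \<otimes>\<^bsub>free_algebra R X\<^esub> (f \<oplus>\<^bsub>free_algebra R X\<^esub> g)
      = h \<otimes>\<^bsub>free_algebra R X\<^esub> f \<oplus>\<^bsub>free_algebra R X\<^esub> h \<otimes>\<^bsub>free_algebra R X\<^esub> g"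
  using assms
  by (auto simp: free_algebra_simps free_algebra_coeff_closed l_distr r_distr
      simp flip: finsum_addf intro!: ext)

lemma free_algebra_null:
  assumes "f \<in> carrier (free_algebra R X)"
  shows "\<zero>\<^bsub>free_algebra R X\<^esub> \<otimes>\<^bsub>free_algebra R X\<^esub> f = \<zero>\<^bsub>free_algebra R X\<^esub>"
    and "f \<otimes>\<^bsub>free_algebra R X\<^esub> \<zero>\<^bsub>free_algebra R X\<^esub> = \<zero>\<^bsub>free_algebra R X\<^esub>"
  using assms by (auto simp: free_algebra_simps free_algebra_coeff_closed)

text \<open>Induction on the finite support: setting one nonzero coefficient to zero removes exactly
  one word from it, and the removed part is a monomial.\<close>

lemma free_algebra_induct [consumes 1, case_names zero add]:
  assumes "f \<in> carrier (free_algebra R X)"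
    and "P \<zero>\<^bsub>free_algebra R X\<^esub>"
    and "\<And>a w f. \<lbrakk>a \<in> carrier R; w \<in> lists X; f \<in> carrier (free_algebra R X); P f\<rbrakk>
      \<Longrightarrow> P (word_term R a w \<oplus>\<^bsub>free_algebra R X\<^esub> f)"
  shows "P f"
proof -
  have "finite {w. f w \<noteq> \<zero>}"
    using assms(1) by (simp add: free_algebra_carrier)
  then show ?thesis
    using assms(1)
  proof (induction "{w. f w \<noteq> \<zero>}" arbitrary: f)
    case empty
    then show ?case
      using assms(2) by (simp add: free_algebra_simps)
  next
    case (insert w W)
    let ?g = "f(w := \<zero>)"
    have w: "w \<in> lists X" "f w \<in> carrier R"
      using insert.prems insert.hyps(4) by (auto simp: free_algebra_carrier)
    have g: "?g \<in> carrier (free_algebra R X)"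
      using insert.prems insert.hyps(1,4)
      by (intro free_algebra_carrierI[of _ W]) (auto simp: free_algebra_carrier)
    have "W = {u. ?g u \<noteq> \<zero>}"
      using insert.hyps(2,4) by auto
    then have "P ?g"
      using insert.hyps(3) g by blast
    moreover have "f = word_term R (f w) w \<oplus>\<^bsub>free_algebra R X\<^esub> ?g"
      using insert.prems by (auto simp: free_algebra_simps word_term_def free_algebra_coeff_closed)
    ultimately show ?case
      using assms(3) w g by metis
  qed
qed

text \<open>Among the factorisations of a word \<open>w\<close>, the pair \<open>(u, v)\<close>
  occurs only if \<open>w = u @ v\<close>, and then only at position \<open>length u\<close>. The
  convolution therefore has at most one nonzero term.\<close>

lemma word_term_mult:
  assumes "a \<in> carrier R" "b \<in> carrier R"
  shows "word_term R a u \<otimes>\<^bsub>free_algebra R X\<^esub> word_term R b v = word_term R (a \<otimes> b) (u @ v)"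
proof
  fix w
  show "(word_term R a u \<otimes>\<^bsub>free_algebra R X\<^esub> word_term R b v) w = word_term R (a \<otimes> b) (u @ v) w"
  proof (cases "w = u @ v")
    case True
    have "(word_term R a u \<otimes>\<^bsub>free_algebra R X\<^esub> word_term R b v) w
        = (\<Oplus>i\<in>{..length w}. if length u = i then a \<otimes> b else \<zero>)"
      unfolding free_algebra_simps using assms True
    proof (intro finsum_cong')
      fix i
      assume "i \<in> {..length w}"
      then have "take i w = u \<and> drop i w = v \<longleftrightarrow> length u = i"
        using True by (metis append_eq_conv_conj atMost_iff length_take min.absorb2)
      then show "word_term R a u (take i w) \<otimes> word_term R b v (drop i w)
          = (if length u = i then a \<otimes> b else \<zero>)"
        using assms by (auto simp: word_term_def)
    qed (use assms in auto)
    also have "\<dots> = a \<otimes> b"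
      using finsum_singleton[of "length u" "{..length w}" "\<lambda>_. a \<otimes> b"] assms True by simp
    finally show ?thesis
      using True by (simp add: word_term_def)
  next
    case False
    then have "take i w \<noteq> u \<or> drop i w \<noteq> v" for i
      by (metis append_take_drop_id)
    then have "word_term R a u (take i w) \<otimes> word_term R b v (drop i w) = \<zero>" for i
      using assms by (auto simp: word_term_def)
    then show ?thesis
      using False by (simp add: free_algebra_simps(5)) (simp add: word_term_def)
  qed
qed

text \<open>Both sides are additive in each factor, so three inductions reduce \<open>h\<close>,
  then \<open>g\<close>, then \<open>f\<close> to monomials. There the claim is associativity of
  \<open>@\<close> and of the multiplication of coefficients.\<close>

lemma free_algebra_mult_assoc:
  assumes f: "f \<in> carrier (free_algebra R X)" and g: "g \<in> carrier (free_algebra R X)"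
    and h: "h \<in> carrier (free_algebra R X)"
  shows "f \<otimes>\<^bsub>free_algebra R X\<^esub> g \<otimes>\<^bsub>free_algebra R X\<^esub> h
      = f \<otimes>\<^bsub>free_algebra R X\<^esub> (g \<otimes>\<^bsub>free_algebra R X\<^esub> h)"
proof -
  note [simp] = free_algebra_null free_algebra_distr free_algebra_mult_closed word_term_closed
    word_term_mult m_assoc abelian_groupE(1)[OF free_algebra_abelian_group]
  have terms: "word_term R a u \<otimes>\<^bsub>free_algebra R X\<^esub> word_term R b v \<otimes>\<^bsub>free_algebra R X\<^esub> h
      = word_term R a u \<otimes>\<^bsub>free_algebra R X\<^esub> (word_term R b v \<otimes>\<^bsub>free_algebra R X\<^esub> h)"
    if "a \<in> carrier R" "u \<in> lists X" "b \<in> carrier R" "v \<in> lists X" for a u b v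
    using h by (induction rule: free_algebra_induct) (use that in simp_all)
  have left: "word_term R a u \<otimes>\<^bsub>free_algebra R X\<^esub> g \<otimes>\<^bsub>free_algebra R X\<^esub> h
      = word_term R a u \<otimes>\<^bsub>free_algebra R X\<^esub> (g \<otimes>\<^bsub>free_algebra R X\<^esub> h)"
    if "a \<in> carrier R" "u \<in> lists X" for a u
    using g by (induction rule: free_algebra_induct) (use that h terms in simp_all)
  show ?thesis
    using f by (induction rule: free_algebra_induct) (use g h left in simp_all)
qed

lemma free_algebra_mult_one:
  assumes "f \<in> carrier (free_algebra R X)"
  shows "\<one>\<^bsub>free_algebra R X\<^esub> \<otimes>\<^bsub>free_algebra R X\<^esub> f = f"
    and "f \<otimes>\<^bsub>free_algebra R X\<^esub> \<one>\<^bsub>free_algebra R X\<^esub> = f"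
  using assms
  by (induction rule: free_algebra_induct)
     (simp_all add: free_algebra_simps(2) free_algebra_null free_algebra_distr word_term_closed
      word_term_mult)

lemma free_algebra_assoc_algebra: "assoc_algebra R (free_algebra R X)"
proof -
  interpret F: module R "free_algebra R X" by (rule free_algebra_module)
  have "ring (free_algebra R X)"
    by (rule ringI)
       (auto intro!: monoidI simp: free_algebra_abelian_group free_algebra_mult_closed
        free_algebra_mult_assoc free_algebra_mult_one free_algebra_distr word_term_closed
        free_algebra_one_closed)
  moreover have "assoc_algebra_axioms R (free_algebra R X)"
    by unfold_locales
       (auto simp: free_algebra_simps free_algebra_coeff_closed finsum_rdistr m_assoc m_lcomm
        intro!: ext finsum_cong')
  ultimately show ?thesis
    by (intro assoc_algebra.intro free_algebra_module)
qed

end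

section \<open>Evaluation of noncommutative polynomials\<close>

definition word_eval :: "('a, 'm) monoid_scheme \<Rightarrow> ('x \<Rightarrow> 'a) \<Rightarrow> 'x list \<Rightarrow> 'a"
  where "word_eval M \<phi> w = foldr (\<lambda>x y. \<phi> x \<otimes>\<^bsub>M\<^esub> y) w \<one>\<^bsub>M\<^esub>"

text \<open>This is the homomorphism of the universal property of the free algebra. The sum runs
  over the support, because \<open>finsum\<close> is a genuine sum only over finite index
  sets.\<close>

definition free_eval ::
    "('k, 'm) ring_scheme \<Rightarrow> ('k, 'a, 'c) module_scheme \<Rightarrow> ('x \<Rightarrow> 'a) \<Rightarrow> ('x list \<Rightarrow> 'k) \<Rightarrow> 'a"
  where "free_eval K M \<phi> f = (\<Oplus>\<^bsub>M\<^esub>w\<in>{w. f w \<noteq> \<zero>\<^bsub>K\<^esub>}. f w \<odot>\<^bsub>M\<^esub> word_eval M \<phi> w)"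

context assoc_algebra
begin

context
  fixes \<phi> :: "'x \<Rightarrow> 'c" and X :: "'x set"
  assumes \<phi>: "\<phi> \<in> X \<rightarrow> carrier M"
begin

lemma word_eval_closed: "w \<in> lists X \<Longrightarrow> word_eval M \<phi> w \<in> carrier M"
  using \<phi> by (induction w) (auto simp: word_eval_def)

lemma word_eval_append:
  "\<lbrakk>u \<in> lists X; v \<in> lists X\<rbrakk>
    \<Longrightarrow> word_eval M \<phi> (u @ v) = word_eval M \<phi> u \<otimes>\<^bsub>M\<^esub> word_eval M \<phi> v"
proof (induction u)
  case Nil
  then show ?case
    using word_eval_closed[of v] by (simp add: word_eval_def)
next
  case (Cons x u)
  then show ?case
    using word_eval_closed[of u] word_eval_closed[of v] \<phi>
    by (auto simp: word_eval_def M.m_assoc Pi_iff)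
qed

text \<open>The additional summands have coefficient zero. Enlarging the index set allows
  evaluations of elements with different supports to be compared termwise.\<close>

lemma free_eval_superset:
  assumes "f \<in> carrier (free_algebra R X)" "finite S" "{w. f w \<noteq> \<zero>} \<subseteq> S" "S \<subseteq> lists X"
  shows "free_eval R M \<phi> f = (\<Oplus>\<^bsub>M\<^esub>w\<in>S. f w \<odot>\<^bsub>M\<^esub> word_eval M \<phi> w)"
  unfolding free_eval_def
proof (rule M.add.finprod_mono_neutral_cong_left)
  show "(\<lambda>w. f w \<odot>\<^bsub>M\<^esub> word_eval M \<phi> w) \<in> S \<rightarrow> carrier M"
    using assms word_eval_closed by (auto simp: R.free_algebra_coeff_closed subset_iff)
  show "f w \<odot>\<^bsub>M\<^esub> word_eval M \<phi> w = \<zero>\<^bsub>M\<^esub>" if "w \<in> S - {w. f w \<noteq> \<zero>}" for w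
    using that assms(4) word_eval_closed by (simp add: subset_iff)
qed (use assms in auto)

lemma free_eval_closed:
  "f \<in> carrier (free_algebra R X) \<Longrightarrow> free_eval R M \<phi> f \<in> carrier M"
  unfolding free_eval_def
  by (rule M.finsum_closed) (auto simp: R.free_algebra_carrier intro!: word_eval_closed)

lemma free_eval_add:
  assumes f: "f \<in> carrier (free_algebra R X)" and g: "g \<in> carrier (free_algebra R X)"
  shows "free_eval R M \<phi> (f \<oplus>\<^bsub>free_algebra R X\<^esub> g)
    = free_eval R M \<phi> f \<oplus>\<^bsub>M\<^esub> free_eval R M \<phi> g"
proof -
  \<comment> \<open>Cancellation can make the support of the sum smaller than this union, so all
    three evaluations are taken over the common set \<open>?S\<close>.\<close>
  let ?S = "{w. f w \<noteq> \<zero>} \<union> {w. g w \<noteq> \<zero>}"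
  have S: "finite ?S" "?S \<subseteq> lists X"
    using f g by (auto simp: R.free_algebra_carrier)
  have fg: "f \<oplus>\<^bsub>free_algebra R X\<^esub> g \<in> carrier (free_algebra R X)"
    using abelian_groupE(1)[OF R.free_algebra_abelian_group] f g .
  have "free_eval R M \<phi> (f \<oplus>\<^bsub>free_algebra R X\<^esub> g)
      = (\<Oplus>\<^bsub>M\<^esub>w\<in>?S. (f \<oplus>\<^bsub>free_algebra R X\<^esub> g) w \<odot>\<^bsub>M\<^esub> word_eval M \<phi> w)"
    by (rule free_eval_superset) (use fg S in \<open>auto simp: R.free_algebra_simps\<close>)
  also have "\<dots> = (\<Oplus>\<^bsub>M\<^esub>w\<in>?S. f w \<odot>\<^bsub>M\<^esub> word_eval M \<phi> w \<oplus>\<^bsub>M\<^esub> g w \<odot>\<^bsub>M\<^esub> word_eval M \<phi> w)"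
    using f g S word_eval_closed
    by (intro M.finsum_cong') (auto simp: R.free_algebra_simps(3) R.free_algebra_coeff_closed
      smult_l_distr subset_iff)
  also have "\<dots> = (\<Oplus>\<^bsub>M\<^esub>w\<in>?S. f w \<odot>\<^bsub>M\<^esub> word_eval M \<phi> w) \<oplus>\<^bsub>M\<^esub> (\<Oplus>\<^bsub>M\<^esub>w\<in>?S. g w \<odot>\<^bsub>M\<^esub> word_eval M \<phi> w)"
    using f g S word_eval_closed
    by (intro M.finsum_addf) (auto simp: R.free_algebra_coeff_closed subset_iff)
  finally show ?thesis
    using f g S free_eval_superset[of f ?S] free_eval_superset[of g ?S] by simp
qed

lemma free_eval_zero: "free_eval R M \<phi> \<zero>\<^bsub>free_algebra R X\<^esub> = \<zero>\<^bsub>M\<^esub>"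
  by (simp add: free_eval_def R.free_algebra_simps)

lemma free_eval_word_term:
  assumes "a \<in> carrier R" "w \<in> lists X"
  shows "free_eval R M \<phi> (word_term R a w) = a \<odot>\<^bsub>M\<^esub> word_eval M \<phi> w"
proof -
  \<comment> \<open>For \<open>a = \<zero>\<close> the support is empty, so the sum over
    \<open>{w}\<close> covers both cases.\<close>
  have "free_eval R M \<phi> (word_term R a w)
      = (\<Oplus>\<^bsub>M\<^esub>u\<in>{w}. word_term R a w u \<odot>\<^bsub>M\<^esub> word_eval M \<phi> u)"
    using assms by (intro free_eval_superset R.word_term_closed) (auto simp: word_term_def)
  then show ?thesis
    using assms word_eval_closed[of w] by (simp add: word_term_def)
qed

lemma free_eval_smult:
  assumes "a \<in> carrier R" "f \<in> carrier (free_algebra R X)"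
  shows "free_eval R M \<phi> (a \<odot>\<^bsub>free_algebra R X\<^esub> f) = a \<odot>\<^bsub>M\<^esub> free_eval R M \<phi> f"
proof -
  interpret F: assoc_algebra R "free_algebra R X" by (rule R.free_algebra_assoc_algebra)
  have word: "a \<odot>\<^bsub>free_algebra R X\<^esub> word_term R b w = word_term R (a \<otimes> b) w"
    if "b \<in> carrier R" for b w
    using assms(1) that by (auto simp: R.free_algebra_simps word_term_def)
  show ?thesis
    using assms(2)
    by (induction rule: R.free_algebra_induct)
       (use assms(1) in \<open>simp_all add: word free_eval_zero free_eval_add R.word_term_closed
        F.smult_r_distr smult_r_distr free_eval_word_term free_eval_closed word_eval_closed
        smult_assoc1\<close>)
qed

text \<open>Both sides are biadditive, so nested inductions reduce the claim to monomials. There it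
  follows from \<open>word_eval_append\<close>, since scalars can be pulled out of either factor of
  a product.\<close>

lemma free_eval_mult:
  assumes f: "f \<in> carrier (free_algebra R X)" and g: "g \<in> carrier (free_algebra R X)"
  shows "free_eval R M \<phi> (f \<otimes>\<^bsub>free_algebra R X\<^esub> g)
    = free_eval R M \<phi> f \<otimes>\<^bsub>M\<^esub> free_eval R M \<phi> g"
proof -
  interpret F: assoc_algebra R "free_algebra R X" by (rule R.free_algebra_assoc_algebra)
  note [simp] = free_eval_zero free_eval_add free_eval_closed free_eval_word_term
    R.word_term_closed R.word_term_mult word_eval_closed
  have "free_eval R M \<phi> (word_term R a u \<otimes>\<^bsub>free_algebra R X\<^esub> g)
      = free_eval R M \<phi> (word_term R a u) \<otimes>\<^bsub>M\<^esub> free_eval R M \<phi> g"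
    if "a \<in> carrier R" "u \<in> lists X" for a u
    using g
  proof (induction rule: R.free_algebra_induct)
    case (add b v g)
    have "word_eval M \<phi> (u @ v) = word_eval M \<phi> u \<otimes>\<^bsub>M\<^esub> word_eval M \<phi> v"
      using word_eval_append that add by blast
    then show ?case
      using that add by (simp add: F.r_distr M.r_distr smult_assoc2 smult_assoc3 R.m_comm
        append_in_lists_conv del: in_lists_conv_set flip: smult_assoc1)
  qed (use that in simp)
  with f show ?thesis
    by (induction rule: R.free_algebra_induct) (use g in \<open>simp_all add: F.l_distr M.l_distr\<close>)
qed

lemma free_eval_hom: "free_eval R M \<phi> \<in> algebra_hom R (free_algebra R X) M"
proof -
  have "free_eval R M \<phi> \<one>\<^bsub>free_algebra R X\<^esub> = \<one>\<^bsub>M\<^esub>"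
    by (simp add: R.free_algebra_simps(2) free_eval_word_term) (simp add: word_eval_def)
  then show ?thesis
    by (auto simp: algebra_hom_def free_eval_closed free_eval_mult free_eval_add free_eval_smult
      intro!: ring_hom_memI)
qed

lemma free_eval_letter: "x \<in> X \<Longrightarrow> free_eval R M \<phi> (letter R x) = \<phi> x"
  using \<phi> by (simp add: letter_eq_word_term free_eval_word_term) (simp add: word_eval_def Pi_iff)

end

end

section \<open>Quotient algebras\<close>

lemma quot_algebra_simps:
  "carrier (quot_algebra F I) = carrier (F Quot I)"
  "mult (quot_algebra F I) = mult (F Quot I)"
  "one (quot_algebra F I) = one (F Quot I)"
  "zero (quot_algebra F I) = zero (F Quot I)"
  "add (quot_algebra F I) = add (F Quot I)"
  "a \<odot>\<^bsub>quot_algebra F I\<^esub> A = (\<Union>f\<in>A. I +>\<^bsub>F\<^esub> (a \<odot>\<^bsub>F\<^esub> f))"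
  by (simp_all add: quot_algebra_def ring.extend_def module.fields_def)

text \<open>\<open>quot_algebra F I\<close> and \<open>F Quot I\<close> are different records with
  the same ring operations, so the ring axioms are carried over one at a time.\<close>

lemma ring_quot_algebra:
  assumes "ideal I F"
  shows "ring (quot_algebra F I)"
proof -
  interpret Q: ring "F Quot I"
    by (rule ideal.quotient_is_ring[OF assms])
  show ?thesis
  proof (intro ringI abelian_groupI monoidI)
    show "\<exists>y\<in>carrier (quot_algebra F I). y \<oplus>\<^bsub>quot_algebra F I\<^esub> x = \<zero>\<^bsub>quot_algebra F I\<^esub>"
      if "x \<in> carrier (quot_algebra F I)" for x
      using that Q.l_neg Q.a_inv_closed unfolding quot_algebra_simps by blast
  qed (simp_all add: quot_algebra_simps Q.a_ac Q.m_assoc Q.l_distr Q.r_distr)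
qed

lemma carrier_quot_algebra: "carrier (quot_algebra F I) = (\<lambda>x. I +>\<^bsub>F\<^esub> x) ` carrier F"
  by (auto simp: quot_algebra_simps FactRing_simps)

context assoc_algebra
begin

context
  fixes I
  assumes I: "ideal I M"
begin

interpretation I: ideal I M by (rule I)

text \<open>Scaling by \<open>a\<close> is left multiplication by \<open>a \<odot> \<one>\<close>,
  so a two-sided ideal of the ring is automatically a subspace.\<close>

lemma ideal_smult_closed:
  assumes "a \<in> carrier R" "x \<in> I"
  shows "a \<odot>\<^bsub>M\<^esub> x \<in> I"
proof -
  have "a \<odot>\<^bsub>M\<^esub> x = (a \<odot>\<^bsub>M\<^esub> \<one>\<^bsub>M\<^esub>) \<otimes>\<^bsub>M\<^esub> x"
    using assms by (simp add: smult_assoc2)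
  then show ?thesis
    using assms by (simp add: I.I_l_closed)
qed

text \<open>The union that defines the scalar action ranges over the representatives of the coset.
  Two of them differ by an element of \<open>I\<close>, and so do their multiples by
  \<open>a\<close>; hence all members of the union are the same coset.\<close>

lemma quot_algebra_smult:
  assumes "a \<in> carrier R" "x \<in> carrier M"
  shows "a \<odot>\<^bsub>quot_algebra M I\<^esub> (I +>\<^bsub>M\<^esub> x) = I +>\<^bsub>M\<^esub> (a \<odot>\<^bsub>M\<^esub> x)"
proof -
  have const: "I +>\<^bsub>M\<^esub> (a \<odot>\<^bsub>M\<^esub> y) = I +>\<^bsub>M\<^esub> (a \<odot>\<^bsub>M\<^esub> x)" if y: "y \<in> I +>\<^bsub>M\<^esub> x" for y
  proof -
    obtain i where i: "i \<in> I" "y = i \<oplus>\<^bsub>M\<^esub> x"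
      using y by (auto simp: a_r_coset_defs)
    then have "a \<odot>\<^bsub>M\<^esub> y = (a \<odot>\<^bsub>M\<^esub> i) \<oplus>\<^bsub>M\<^esub> (a \<odot>\<^bsub>M\<^esub> x)"
      using assms by (simp add: smult_r_distr)
    then have "a \<odot>\<^bsub>M\<^esub> y \<in> I +>\<^bsub>M\<^esub> (a \<odot>\<^bsub>M\<^esub> x)"
      using ideal_smult_closed[OF assms(1) i(1)] by (auto simp: a_r_coset_defs)
    then show ?thesis
      by (rule I.a_repr_independence'[symmetric]) (simp add: assms)
  qed
  show ?thesis
    unfolding quot_algebra_simps
    using I.a_rcos_self[OF assms(2)] by (intro SUP_eq_const const) auto
qed

lemma rcoset_algebra_hom: "(+>\<^bsub>M\<^esub>) I \<in> algebra_hom R M (quot_algebra M I)"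
  using I.rcos_ring_hom
  by (simp add: algebra_hom_def quot_algebra_smult ring_hom_def quot_algebra_simps(1-5))

lemma quot_algebra_assoc_algebra: "assoc_algebra R (quot_algebra M I)"
proof -
  interpret Q: ring "quot_algebra M I" by (rule ring_quot_algebra[OF I])
  note hom = algebra_hom_add algebra_hom_mult algebra_hom_smult
  \<comment> \<open>Read from right to left, the laws of the projection turn operations on cosets
    into cosets of operations in \<open>M\<close>, where the axioms are known.\<close>
  note [simp] = hom[OF rcoset_algebra_hom, symmetric]
  have "module R (quot_algebra M I)"
    by (rule moduleI)
       (auto simp: carrier_quot_algebra smult_l_distr smult_r_distr smult_assoc1
        R.is_cring Q.abelian_group_axioms)
  moreover have "assoc_algebra_axioms R (quot_algebra M I)"
    by unfold_locales (auto simp: carrier_quot_algebra smult_assoc2 smult_assoc3)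
  ultimately show ?thesis
    by (intro assoc_algebra.intro Q.ring_axioms)
qed

lemma quot_algebra_lift:
  assumes "assoc_algebra R N" "h \<in> algebra_hom R M N" "\<And>x. x \<in> I \<Longrightarrow> h x = \<zero>\<^bsub>N\<^esub>"
  obtains g where "g \<in> algebra_hom R (quot_algebra M I) N"
    "\<And>x. x \<in> carrier M \<Longrightarrow> g (I +>\<^bsub>M\<^esub> x) = h x"
proof -
  interpret N: assoc_algebra R N by fact
  note hom = algebra_hom_add algebra_hom_mult algebra_hom_smult
  \<comment> \<open>A value is chosen through some representative. Any two representatives differ by
    an element of \<open>I\<close>, which \<open>h\<close> sends to zero, so the choice does not
    matter.\<close>
  define g where "g A = h (SOME x. x \<in> A)" for A
  have g: "g (I +>\<^bsub>M\<^esub> x) = h x" if x: "x \<in> carrier M" for x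
  proof -
    have "(SOME y. y \<in> I +>\<^bsub>M\<^esub> x) \<in> I +>\<^bsub>M\<^esub> x"
      using I.a_rcos_self[OF x] by (rule someI)
    then obtain i where "i \<in> I" "(SOME y. y \<in> I +>\<^bsub>M\<^esub> x) = i \<oplus>\<^bsub>M\<^esub> x"
      by (auto simp: a_r_coset_defs)
    then show ?thesis
      using x assms(3) algebra_hom_closed[OF assms(2)]
      by (simp add: g_def algebra_hom_add[OF assms(2)])
  qed
  have "g \<in> ring_hom (quot_algebra M I) N"
  proof (rule ring_hom_memI)
    show "g \<one>\<^bsub>quot_algebra M I\<^esub> = \<one>\<^bsub>N\<^esub>"
      using g[OF M.one_closed] algebra_hom_one[OF assms(2)] algebra_hom_one[OF rcoset_algebra_hom]
      by simp
  qed (auto simp: carrier_quot_algebra g algebra_hom_closed[OF assms(2)] hom[OF assms(2)]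
      simp flip: hom[OF rcoset_algebra_hom])
  then have "g \<in> algebra_hom R (quot_algebra M I) N"
    by (auto simp: algebra_hom_def carrier_quot_algebra g hom[OF assms(2)]
        simp flip: hom[OF rcoset_algebra_hom])
  then show ?thesis
    using g that by blast
qed

end

end

section \<open>The universal property of the Leavitt path algebra of the rose\<close>

lemma (in ring) minus_eq_zero_iff:
  "\<lbrakk>x \<in> carrier R; y \<in> carrier R\<rbrakk> \<Longrightarrow> x \<ominus> y = \<zero> \<longleftrightarrow> x = y"
  by (metis a_inv_closed minus_eq minus_equality minus_minus r_neg)

lemma (in ring_hom_ring) hom_minus:
  "\<lbrakk>x \<in> carrier R; y \<in> carrier R\<rbrakk> \<Longrightarrow> h (x \<ominus> y) = h x \<ominus>\<^bsub>S\<^esub> h y"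
  by (simp add: a_minus_def)

text \<open>These are the Leavitt relations with the vertex already replaced by the unit. Such pairs
  of families are the admissible images of the edges and ghost edges.\<close>

definition leavitt_family :: "('a, 'm) ring_scheme \<Rightarrow> nat \<Rightarrow> (nat \<Rightarrow> 'a) \<Rightarrow> (nat \<Rightarrow> 'a) \<Rightarrow> bool"
  where "leavitt_family M n \<epsilon> \<gamma> \<longleftrightarrow>
    \<epsilon> \<in> {1..n} \<rightarrow> carrier M \<and> \<gamma> \<in> {1..n} \<rightarrow> carrier M \<and>
    (\<forall>i\<in>{1..n}. \<forall>j\<in>{1..n}. \<gamma> i \<otimes>\<^bsub>M\<^esub> \<epsilon> j = (if i = j then \<one>\<^bsub>M\<^esub> else \<zero>\<^bsub>M\<^esub>)) \<and>
    (\<Oplus>\<^bsub>M\<^esub>i\<in>{1..n}. \<epsilon> i \<otimes>\<^bsub>M\<^esub> \<gamma> i) = \<one>\<^bsub>M\<^esub>"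

context cring
begin

lemma rose_free_assoc_algebra: "assoc_algebra R (rose_free R n)"
  by (simp add: rose_free_def free_algebra_assoc_algebra)

lemma rose_letter_closed: "x \<in> rose_gens n \<Longrightarrow> letter R x \<in> carrier (rose_free R n)"
  by (simp add: rose_free_def letter_eq_word_term word_term_closed)

lemma rose_letters_closed:
  "letter R Vertex \<in> carrier (rose_free R n)"
  "i \<in> {1..n} \<Longrightarrow> letter R (Edge i) \<in> carrier (rose_free R n)"
  "i \<in> {1..n} \<Longrightarrow> letter R (Ghost i) \<in> carrier (rose_free R n)"
  by (auto intro!: rose_letter_closed simp: rose_gens_def)

lemma rose_sum_closed:
  "(\<Oplus>\<^bsub>rose_free R n\<^esub>i\<in>{1..n}. letter R (Edge i) \<otimes>\<^bsub>rose_free R n\<^esub> letter R (Ghost i))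
    \<in> carrier (rose_free R n)"
proof -
  interpret F: assoc_algebra R "rose_free R n" by (rule rose_free_assoc_algebra)
  show ?thesis
    using rose_letters_closed by (intro F.finsum_closed) auto
qed

lemma rose_relations_closed: "rose_relations R n \<subseteq> carrier (rose_free R n)"
proof -
  interpret F: assoc_algebra R "rose_free R n" by (rule rose_free_assoc_algebra)
  show ?thesis
    using rose_letters_closed[of n] rose_letters_closed(2,3)[of _ n] rose_sum_closed[of n]
    by (auto simp: rose_relations_def Let_def)
qed

text \<open>A homomorphism kills \<open>l - r\<close> precisely if it identifies \<open>l\<close>
  and \<open>r\<close>. The equivalence serves in both directions: for the projection it yields the
  relations in the quotient, and for an evaluation it shows that the map factors through the
  quotient.\<close>

lemma rose_relations_killed_iff:
  assumes "assoc_algebra R M" and h: "h \<in> algebra_hom R (rose_free R n) M"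
  shows "(\<forall>r\<in>rose_relations R n. h r = \<zero>\<^bsub>M\<^esub>) \<longleftrightarrow>
    h (letter R Vertex) = \<one>\<^bsub>M\<^esub> \<and>
    leavitt_family M n (\<lambda>i. h (letter R (Edge i))) (\<lambda>i. h (letter R (Ghost i)))"
proof -
  interpret F: assoc_algebra R "rose_free R n" by (rule rose_free_assoc_algebra)
  interpret M: assoc_algebra R M by fact
  interpret h: ring_hom_ring "rose_free R n" M h
    by (rule algebra_hom_ring_hom_ring[OF F.assoc_algebra_axioms M.assoc_algebra_axioms h])
  note closed = rose_letters_closed[where n = n]
  have "h (\<Oplus>\<^bsub>rose_free R n\<^esub>i\<in>{1..n}. letter R (Edge i) \<otimes>\<^bsub>rose_free R n\<^esub> letter R (Ghost i))
    = (\<Oplus>\<^bsub>M\<^esub>i\<in>{1..n}. h (letter R (Edge i) \<otimes>\<^bsub>rose_free R n\<^esub> letter R (Ghost i)))"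
    by (rule h.hom_finsum[unfolded comp_def]) (use closed in auto)
  also have "\<dots> = (\<Oplus>\<^bsub>M\<^esub>i\<in>{1..n}. h (letter R (Edge i)) \<otimes>\<^bsub>M\<^esub> h (letter R (Ghost i)))"
    by (rule M.finsum_cong') (use closed in auto)
  finally have sum: "h (\<Oplus>\<^bsub>rose_free R n\<^esub>i\<in>{1..n}. letter R (Edge i) \<otimes>\<^bsub>rose_free R n\<^esub> letter R (Ghost i))
    = (\<Oplus>\<^bsub>M\<^esub>i\<in>{1..n}. h (letter R (Edge i)) \<otimes>\<^bsub>M\<^esub> h (letter R (Ghost i)))" .
  have minus: "h (x \<ominus>\<^bsub>rose_free R n\<^esub> y) = \<zero>\<^bsub>M\<^esub> \<longleftrightarrow> h x = h y"
    if "x \<in> carrier (rose_free R n)" "y \<in> carrier (rose_free R n)" for x y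
    using that by (simp add: h.hom_minus M.minus_eq_zero_iff)
  let ?v = "letter R Vertex" and ?e = "\<lambda>i. letter R (Edge i)" and ?e' = "\<lambda>i. letter R (Ghost i)"
  let ?F = "rose_free R n"
  have vertex: "h (?v \<ominus>\<^bsub>?F\<^esub> \<one>\<^bsub>?F\<^esub>) = \<zero>\<^bsub>M\<^esub> \<longleftrightarrow> h ?v = \<one>\<^bsub>M\<^esub>"
    "h (?v \<otimes>\<^bsub>?F\<^esub> ?v \<ominus>\<^bsub>?F\<^esub> ?v) = \<zero>\<^bsub>M\<^esub> \<longleftrightarrow> h ?v \<otimes>\<^bsub>M\<^esub> h ?v = h ?v"
    using closed(1) by (simp_all add: minus)
  have unit: "h (?v \<otimes>\<^bsub>?F\<^esub> x \<ominus>\<^bsub>?F\<^esub> x) = \<zero>\<^bsub>M\<^esub> \<longleftrightarrow> h ?v \<otimes>\<^bsub>M\<^esub> h x = h x"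
    "h (x \<otimes>\<^bsub>?F\<^esub> ?v \<ominus>\<^bsub>?F\<^esub> x) = \<zero>\<^bsub>M\<^esub> \<longleftrightarrow> h x \<otimes>\<^bsub>M\<^esub> h ?v = h x"
    if "x \<in> carrier ?F" for x
    using closed(1) that by (simp_all add: minus)
  have orth: "h (?e' i \<otimes>\<^bsub>?F\<^esub> ?e j \<ominus>\<^bsub>?F\<^esub> (if i = j then ?v else \<zero>\<^bsub>?F\<^esub>)) = \<zero>\<^bsub>M\<^esub>
      \<longleftrightarrow> h (?e' i) \<otimes>\<^bsub>M\<^esub> h (?e j) = (if i = j then h ?v else \<zero>\<^bsub>M\<^esub>)"
    if "i \<in> {1..n}" "j \<in> {1..n}" for i j
    by (subst minus) (use closed(1) closed(2,3)[OF that(1)] closed(2,3)[OF that(2)] in auto)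
  have total: "h ((\<Oplus>\<^bsub>?F\<^esub>i\<in>{1..n}. ?e i \<otimes>\<^bsub>?F\<^esub> ?e' i) \<ominus>\<^bsub>?F\<^esub> ?v) = \<zero>\<^bsub>M\<^esub>
      \<longleftrightarrow> (\<Oplus>\<^bsub>M\<^esub>i\<in>{1..n}. h (?e i) \<otimes>\<^bsub>M\<^esub> h (?e' i)) = h ?v"
    unfolding minus[OF rose_sum_closed closed(1)] sum ..
  have "(\<forall>r\<in>rose_relations R n. h r = \<zero>\<^bsub>M\<^esub>) \<longleftrightarrow>
      h (?v \<ominus>\<^bsub>?F\<^esub> \<one>\<^bsub>?F\<^esub>) = \<zero>\<^bsub>M\<^esub> \<and> h (?v \<otimes>\<^bsub>?F\<^esub> ?v \<ominus>\<^bsub>?F\<^esub> ?v) = \<zero>\<^bsub>M\<^esub> \<and>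
      (\<forall>i\<in>{1..n}. h (?v \<otimes>\<^bsub>?F\<^esub> ?e i \<ominus>\<^bsub>?F\<^esub> ?e i) = \<zero>\<^bsub>M\<^esub> \<and> h (?e i \<otimes>\<^bsub>?F\<^esub> ?v \<ominus>\<^bsub>?F\<^esub> ?e i) = \<zero>\<^bsub>M\<^esub> \<and>
        h (?v \<otimes>\<^bsub>?F\<^esub> ?e' i \<ominus>\<^bsub>?F\<^esub> ?e' i) = \<zero>\<^bsub>M\<^esub> \<and> h (?e' i \<otimes>\<^bsub>?F\<^esub> ?v \<ominus>\<^bsub>?F\<^esub> ?e' i) = \<zero>\<^bsub>M\<^esub>) \<and>
      (\<forall>i\<in>{1..n}. \<forall>j\<in>{1..n}.
        h (?e' i \<otimes>\<^bsub>?F\<^esub> ?e j \<ominus>\<^bsub>?F\<^esub> (if i = j then ?v else \<zero>\<^bsub>?F\<^esub>)) = \<zero>\<^bsub>M\<^esub>) \<and>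
      h ((\<Oplus>\<^bsub>?F\<^esub>i\<in>{1..n}. ?e i \<otimes>\<^bsub>?F\<^esub> ?e' i) \<ominus>\<^bsub>?F\<^esub> ?v) = \<zero>\<^bsub>M\<^esub>"
    unfolding rose_relations_def Let_def by blast
  also have "\<dots> \<longleftrightarrow> h ?v = \<one>\<^bsub>M\<^esub> \<and> h ?v \<otimes>\<^bsub>M\<^esub> h ?v = h ?v \<and>
      (\<forall>i\<in>{1..n}. h ?v \<otimes>\<^bsub>M\<^esub> h (?e i) = h (?e i) \<and> h (?e i) \<otimes>\<^bsub>M\<^esub> h ?v = h (?e i) \<and>
        h ?v \<otimes>\<^bsub>M\<^esub> h (?e' i) = h (?e' i) \<and> h (?e' i) \<otimes>\<^bsub>M\<^esub> h ?v = h (?e' i)) \<and>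
      (\<forall>i\<in>{1..n}. \<forall>j\<in>{1..n}.
        h (?e' i) \<otimes>\<^bsub>M\<^esub> h (?e j) = (if i = j then h ?v else \<zero>\<^bsub>M\<^esub>)) \<and>
      (\<Oplus>\<^bsub>M\<^esub>i\<in>{1..n}. h (?e i) \<otimes>\<^bsub>M\<^esub> h (?e' i)) = h ?v"
    by (simp only: vertex unit closed orth total cong: ball_cong)
  also have "\<dots> \<longleftrightarrow> h ?v = \<one>\<^bsub>M\<^esub> \<and> leavitt_family M n (\<lambda>i. h (?e i)) (\<lambda>i. h (?e' i))"
  \<comment> \<open>If \<open>v\<close> goes to the unit, the relations saying that \<open>v\<close>
    acts as an identity are the unit laws of \<open>M\<close>; otherwise both sides are
    false.\<close>
  proof (cases "h ?v = \<one>\<^bsub>M\<^esub>")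
    case True
    have "h (?e i) \<in> carrier M" "h (?e' i) \<in> carrier M" if "i \<in> {1..n}" for i
      using closed(2,3)[OF that] by simp_all
    then show ?thesis
      using True by (simp add: leavitt_family_def Pi_iff)
  qed simp
  finally show ?thesis .
qed

lemma rose_ideal_ideal: "ideal (rose_ideal R n) (rose_free R n)"
  unfolding rose_ideal_def
  by (intro ring.genideal_ideal assoc_algebra.axioms(2)[OF rose_free_assoc_algebra]
      rose_relations_closed)

lemma rose_LPA_assoc_algebra: "assoc_algebra R (rose_LPA R n)"
  unfolding rose_LPA_def
  by (intro assoc_algebra.quot_algebra_assoc_algebra rose_free_assoc_algebra rose_ideal_ideal)

lemma rose_LPA_proj:
  "(+>\<^bsub>rose_free R n\<^esub>) (rose_ideal R n) \<in> algebra_hom R (rose_free R n) (rose_LPA R n)"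
  unfolding rose_LPA_def
  by (intro assoc_algebra.rcoset_algebra_hom rose_free_assoc_algebra rose_ideal_ideal)

lemma rose_elem_closed: "x \<in> rose_gens n \<Longrightarrow> rose_elem R n x \<in> carrier (rose_LPA R n)"
  unfolding rose_elem_def by (intro algebra_hom_closed[OF rose_LPA_proj] rose_letter_closed)

text \<open>The projection kills the relations because they lie in the ideal, so
  \<open>rose_relations_killed_iff\<close> applies to it from left to right.\<close>

lemma rose_LPA_relations:
  "rose_elem R n Vertex = \<one>\<^bsub>rose_LPA R n\<^esub>"
  "leavitt_family (rose_LPA R n) n (\<lambda>i. rose_elem R n (Edge i)) (\<lambda>i. rose_elem R n (Ghost i))"
proof -
  interpret I: ideal "rose_ideal R n" "rose_free R n" by (rule rose_ideal_ideal)
  have "rose_relations R n \<subseteq> rose_ideal R n"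
    unfolding rose_ideal_def by (rule I.genideal_self[OF rose_relations_closed])
  then have "\<forall>r\<in>rose_relations R n. rose_ideal R n +>\<^bsub>rose_free R n\<^esub> r = \<zero>\<^bsub>rose_LPA R n\<^esub>"
    by (auto simp: rose_LPA_def quot_algebra_simps FactRing_def I.a_rcos_const)
  then show "rose_elem R n Vertex = \<one>\<^bsub>rose_LPA R n\<^esub>"
    "leavitt_family (rose_LPA R n) n (\<lambda>i. rose_elem R n (Edge i)) (\<lambda>i. rose_elem R n (Ghost i))"
    by (simp_all add: rose_relations_killed_iff[OF rose_LPA_assoc_algebra rose_LPA_proj]
        rose_elem_def)
qed

text \<open>Evaluation of the free algebra at the given family kills the relations. Its kernel is an
  ideal, so it contains \<open>rose_ideal\<close>, and the evaluation descends to the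
  quotient.\<close>

lemma rose_LPA_lift:
  assumes "assoc_algebra R M" "leavitt_family M n \<epsilon> \<gamma>"
  obtains h where "h \<in> algebra_hom R (rose_LPA R n) M"
    "\<And>i. i \<in> {1..n} \<Longrightarrow> h (rose_elem R n (Edge i)) = \<epsilon> i"
    "\<And>i. i \<in> {1..n} \<Longrightarrow> h (rose_elem R n (Ghost i)) = \<gamma> i"
proof -
  interpret M: assoc_algebra R M by fact
  interpret F: assoc_algebra R "rose_free R n" by (rule rose_free_assoc_algebra)
  \<comment> \<open>The relation \<open>v - 1\<close> forces the value at \<open>Vertex\<close> to
    be the unit.\<close>
  define \<phi> where "\<phi> = case_rose_gen \<one>\<^bsub>M\<^esub> \<epsilon> \<gamma>"
  have \<phi>: "\<phi> \<in> rose_gens n \<rightarrow> carrier M"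
    using assms(2) by (auto simp: \<phi>_def rose_gens_def leavitt_family_def)
  let ?f = "free_eval R M \<phi>"
  have f: "?f \<in> algebra_hom R (rose_free R n) M"
    unfolding rose_free_def by (rule M.free_eval_hom[OF \<phi>])
  interpret f: ring_hom_ring "rose_free R n" M ?f
    by (rule algebra_hom_ring_hom_ring[OF F.assoc_algebra_axioms M.assoc_algebra_axioms f])
  have letters: "?f (letter R x) = \<phi> x" if "x \<in> rose_gens n" for x
    using M.free_eval_letter[OF \<phi> that] .
  have edges: "?f (letter R (Edge i)) = \<epsilon> i" "?f (letter R (Ghost i)) = \<gamma> i" if "i \<in> {1..n}" for i
    using that by (subst letters; auto simp: rose_gens_def \<phi>_def)+
  have "leavitt_family M n (\<lambda>i. ?f (letter R (Edge i))) (\<lambda>i. ?f (letter R (Ghost i)))"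
  proof -
    have "(\<Oplus>\<^bsub>M\<^esub>i\<in>{1..n}. ?f (letter R (Edge i)) \<otimes>\<^bsub>M\<^esub> ?f (letter R (Ghost i)))
      = (\<Oplus>\<^bsub>M\<^esub>i\<in>{1..n}. \<epsilon> i \<otimes>\<^bsub>M\<^esub> \<gamma> i)"
      using assms(2) by (intro M.finsum_cong') (auto simp: edges leavitt_family_def)
    then show ?thesis
      using assms(2) by (auto simp: leavitt_family_def edges)
  qed
  moreover have "?f (letter R Vertex) = \<one>\<^bsub>M\<^esub>"
    by (subst letters) (simp_all add: rose_gens_def \<phi>_def)
  ultimately have "\<forall>r\<in>rose_relations R n. ?f r = \<zero>\<^bsub>M\<^esub>"
    by (simp only: rose_relations_killed_iff[OF assms(1) f])
  then have "rose_relations R n \<subseteq> a_kernel (rose_free R n) M ?f"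
    unfolding a_kernel_def' using rose_relations_closed[of n] by blast
  then have "rose_ideal R n \<subseteq> a_kernel (rose_free R n) M ?f"
    unfolding rose_ideal_def by (rule F.genideal_minimal[OF f.kernel_is_ideal])
  then have kernel: "?f x = \<zero>\<^bsub>M\<^esub>" if "x \<in> rose_ideal R n" for x
    using f.kernel_zero that by blast
  show ?thesis
  proof (rule F.quot_algebra_lift[OF rose_ideal_ideal assms(1) f kernel, folded rose_LPA_def])
    fix g
    assume g: "g \<in> algebra_hom R (rose_LPA R n) M"
      "\<And>x. x \<in> carrier (rose_free R n) \<Longrightarrow> g (rose_ideal R n +>\<^bsub>rose_free R n\<^esub> x) = ?f x"
    show thesis
      by (rule that[OF g(1)]) (simp_all add: rose_elem_def g(2) rose_letters_closed edges)
  qed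
qed

text \<open>Every coset is represented by a sum of scaled words. Closure of \<open>B\<close> under
  products yields the words, closure under scalars their multiples, and closure under addition the
  sums.\<close>

lemma rose_LPA_generated:
  assumes "subring B (rose_LPA R n)" "submodule B R (rose_LPA R n)"
    and gens: "rose_elem R n ` rose_gens n \<subseteq> B"
  shows "carrier (rose_LPA R n) \<subseteq> B"
proof -
  let ?\<pi> = "(+>\<^bsub>rose_free R n\<^esub>) (rose_ideal R n)"
  interpret F: assoc_algebra R "rose_free R n" by (rule rose_free_assoc_algebra)
  interpret L: assoc_algebra R "rose_LPA R n" by (rule rose_LPA_assoc_algebra)
  interpret \<pi>: ring_hom_ring "rose_free R n" "rose_LPA R n" ?\<pi>
    by (rule algebra_hom_ring_hom_ring[OF F.assoc_algebra_axioms L.assoc_algebra_axioms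
          rose_LPA_proj])
  have words: "?\<pi> (word_term R \<one> w) \<in> B" if "w \<in> lists (rose_gens n)" for w
    using that
  proof (induction w)
    case Nil
    have "?\<pi> (word_term R \<one> []) = \<one>\<^bsub>rose_LPA R n\<^esub>"
      using \<pi>.hom_one by (simp add: rose_free_def free_algebra_simps(2))
    then show ?case
      using subringE(3)[OF assms(1)] by simp
  next
    case (Cons x w)
    have "word_term R \<one> (x # w) = letter R x \<otimes>\<^bsub>rose_free R n\<^esub> word_term R \<one> w"
      by (simp add: rose_free_def letter_eq_word_term word_term_mult)
    moreover have "word_term R \<one> w \<in> carrier (rose_free R n)"
      using Cons by (simp add: rose_free_def word_term_closed)
    ultimately have "?\<pi> (word_term R \<one> (x # w))
        = rose_elem R n x \<otimes>\<^bsub>rose_LPA R n\<^esub> ?\<pi> (word_term R \<one> w)"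
      using Cons by (simp add: rose_elem_def rose_letter_closed)
    then show ?case
      using Cons gens subringE(6)[OF assms(1)] by auto
  qed
  have "?\<pi> f \<in> B" if "f \<in> carrier (free_algebra R (rose_gens n))" for f
    using that
  proof (induction rule: free_algebra_induct)
    case zero
    show ?case
      using \<pi>.hom_zero subringE(2)[OF assms(1)] by (simp add: rose_free_def)
  next
    case (add a w f)
    have w: "word_term R \<one> w \<in> carrier (rose_free R n)"
      "word_term R a w \<in> carrier (rose_free R n)" "f \<in> carrier (rose_free R n)"
      using add by (simp_all add: rose_free_def word_term_closed)
    have "word_term R a w = a \<odot>\<^bsub>rose_free R n\<^esub> word_term R \<one> w"
      using add by (auto simp: rose_free_def free_algebra_simps word_term_def)
    then have "?\<pi> (word_term R a w) = a \<odot>\<^bsub>rose_LPA R n\<^esub> ?\<pi> (word_term R \<one> w)"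
      using algebra_hom_smult[OF rose_LPA_proj] add(1) w(1) by simp
    then have "?\<pi> (word_term R a w) \<in> B"
      using words add submodule.smult_closed[OF assms(2)] by simp
    then show ?case
      using subringE(7)[OF assms(1)] add \<pi>.hom_add[OF w(2,3)] by (simp add: rose_free_def)
  qed
  then show ?thesis
    by (auto simp: rose_LPA_def carrier_quot_algebra rose_free_def)
qed

text \<open>The edges and ghost edges generate the algebra together with the vertex, which is the
  unit and is therefore preserved by both homomorphisms.\<close>

lemma rose_LPA_hom_eqI:
  assumes "assoc_algebra R M"
    and g: "g \<in> algebra_hom R (rose_LPA R n) M" and h: "h \<in> algebra_hom R (rose_LPA R n) M"
    and "\<And>i. i \<in> {1..n} \<Longrightarrow> g (rose_elem R n (Edge i)) = h (rose_elem R n (Edge i))"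
    and "\<And>i. i \<in> {1..n} \<Longrightarrow> g (rose_elem R n (Ghost i)) = h (rose_elem R n (Ghost i))"
    and x: "x \<in> carrier (rose_LPA R n)"
  shows "g x = h x"
proof (rule algebra_hom_eq_on_generated[OF rose_LPA_assoc_algebra assms(1) g h])
  show "x \<in> subalgebra_generated R (rose_LPA R n) (rose_elem R n ` rose_gens n)"
    using rose_LPA_generated x by (fastforce simp: subalgebra_generated_def)
  show "g s = h s" if "s \<in> rose_elem R n ` rose_gens n" for s
    using that assms(4,5) algebra_hom_one[OF g] algebra_hom_one[OF h]
    by (auto simp: rose_gens_def rose_LPA_relations(1))
qed (auto intro: rose_elem_closed)

section \<open>The endomorphism that twists one edge and one ghost edge by \<open>p\<close>\<close>

lemma rose_LPA_twist:
  fixes n :: nat and p :: "(rose_gen list \<Rightarrow> 'a) set"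
  defines "L \<equiv> rose_LPA R n" and "e \<equiv> \<lambda>i. rose_elem R n (Edge i)"
    and "e' \<equiv> \<lambda>i. rose_elem R n (Ghost i)"
  assumes n: "n \<ge> 2" and p: "p \<in> carrier L"
  obtains h where "h \<in> algebra_hom R L L"
    "h (e 2) = e 2 \<oplus>\<^bsub>L\<^esub> e 1 \<otimes>\<^bsub>L\<^esub> p" "h (e' 1) = e' 1 \<ominus>\<^bsub>L\<^esub> p \<otimes>\<^bsub>L\<^esub> e' 2"
    "\<And>q. q \<in> rose_subalgebra R n 1 2 \<Longrightarrow> h q = q"
proof -
  interpret L: assoc_algebra R L unfolding L_def by (rule rose_LPA_assoc_algebra)
  have fam: "leavitt_family L n e e'"
    unfolding L_def e_def e'_def by (rule rose_LPA_relations)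
  then have [simp]: "e i \<in> carrier L" "e' i \<in> carrier L" if "i \<in> {1..n}" for i
    using that by (auto simp: leavitt_family_def)
  have [simp]: "e 1 \<in> carrier L" "e 2 \<in> carrier L" "e' 1 \<in> carrier L" "e' 2 \<in> carrier L"
    using n by simp_all
  have orth: "e' i \<otimes>\<^bsub>L\<^esub> e j = (if i = j then \<one>\<^bsub>L\<^esub> else \<zero>\<^bsub>L\<^esub>)"
    if "i \<in> {1..n}" "j \<in> {1..n}" for i j
    using fam that by (simp add: leavitt_family_def)
  define \<epsilon> where "\<epsilon> = e(2 := e 2 \<oplus>\<^bsub>L\<^esub> e 1 \<otimes>\<^bsub>L\<^esub> p)"
  define \<gamma> where "\<gamma> = e'(1 := e' 1 \<ominus>\<^bsub>L\<^esub> p \<otimes>\<^bsub>L\<^esub> e' 2)"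
  have closed: "\<epsilon> i \<in> carrier L" "\<gamma> i \<in> carrier L" if "i \<in> {1..n}" for i
    using that p by (auto simp: \<epsilon>_def \<gamma>_def)
  \<comment> \<open>Once products are bracketed to the right, \<open>orth\<close> no longer matches
    when further factors follow. This form cancels there.\<close>
  have absorb: "e' i \<otimes>\<^bsub>L\<^esub> (e j \<otimes>\<^bsub>L\<^esub> x) = (if i = j then x else \<zero>\<^bsub>L\<^esub>)"
    if "i \<in> {1..n}" "j \<in> {1..n}" "x \<in> carrier L" for i j x
    using orth[OF that(1,2)] that by (simp flip: L.m_assoc)
  \<comment> \<open>The entry in which both modifications contribute is \<open>i = 1\<close>,
    \<open>j = 2\<close>: the product of \<open>e' 1 - p e' 2\<close> and \<open>e 2 + e 1 p\<close>
    is \<open>p - p\<close>, as the other two terms vanish by orthogonality.\<close>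
  have "\<gamma> i \<otimes>\<^bsub>L\<^esub> \<epsilon> j = (if i = j then \<one>\<^bsub>L\<^esub> else \<zero>\<^bsub>L\<^esub>)" if "i \<in> {1..n}" "j \<in> {1..n}" for i j
    using that n p
    by (auto simp: \<epsilon>_def \<gamma>_def L.minus_eq L.l_distr L.r_distr L.l_minus L.r_minus L.m_assoc orth
        absorb L.l_neg)
  moreover have "(\<Oplus>\<^bsub>L\<^esub>i\<in>{1..n}. \<epsilon> i \<otimes>\<^bsub>L\<^esub> \<gamma> i) = \<one>\<^bsub>L\<^esub>"
  proof -
    \<comment> \<open>Only the summands with index 1 or 2 change, so these are split off.\<close>
    have range: "{1..n} = insert 1 (insert 2 {3..n})"
      using n by auto
    have split: "(\<Oplus>\<^bsub>L\<^esub>i\<in>{1..n}. f i) = f 1 \<oplus>\<^bsub>L\<^esub> (f 2 \<oplus>\<^bsub>L\<^esub> (\<Oplus>\<^bsub>L\<^esub>i\<in>{3..n}. f i))"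
      if "f \<in> {1..n} \<rightarrow> carrier L" for f
      using that unfolding range by (subst L.finsum_insert; simp)+
    define S where "S = (\<Oplus>\<^bsub>L\<^esub>i\<in>{3..n}. e i \<otimes>\<^bsub>L\<^esub> e' i)"
    have S: "S \<in> carrier L"
      unfolding S_def by (rule L.finsum_closed) auto
    have "(\<Oplus>\<^bsub>L\<^esub>i\<in>{3..n}. \<epsilon> i \<otimes>\<^bsub>L\<^esub> \<gamma> i) = S"
      unfolding S_def by (rule L.finsum_cong') (auto simp: \<epsilon>_def \<gamma>_def)
    then have "(\<Oplus>\<^bsub>L\<^esub>i\<in>{1..n}. \<epsilon> i \<otimes>\<^bsub>L\<^esub> \<gamma> i)
        = e 1 \<otimes>\<^bsub>L\<^esub> (e' 1 \<ominus>\<^bsub>L\<^esub> p \<otimes>\<^bsub>L\<^esub> e' 2) \<oplus>\<^bsub>L\<^esub> ((e 2 \<oplus>\<^bsub>L\<^esub> e 1 \<otimes>\<^bsub>L\<^esub> p) \<otimes>\<^bsub>L\<^esub> e' 2 \<oplus>\<^bsub>L\<^esub> S)"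
      by (subst split) (use closed in \<open>auto simp: \<epsilon>_def \<gamma>_def\<close>)
    also have "\<dots> = e 1 \<otimes>\<^bsub>L\<^esub> e' 1 \<oplus>\<^bsub>L\<^esub> (e 2 \<otimes>\<^bsub>L\<^esub> e' 2 \<oplus>\<^bsub>L\<^esub> S)"
    proof -
      \<comment> \<open>In the application \<open>c\<close> is \<open>e 1 p e' 2\<close>, which
        comes with a minus sign from the first summand and a plus sign from the second.\<close>
      have "a \<oplus>\<^bsub>L\<^esub> \<ominus>\<^bsub>L\<^esub> c \<oplus>\<^bsub>L\<^esub> (b \<oplus>\<^bsub>L\<^esub> c \<oplus>\<^bsub>L\<^esub> S) = a \<oplus>\<^bsub>L\<^esub> (b \<oplus>\<^bsub>L\<^esub> S)"
        if "a \<in> carrier L" "b \<in> carrier L" "c \<in> carrier L" for a b c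
        using that S by (simp add: L.a_ac L.r_neg L.r_neg1 L.r_neg2)
      then show ?thesis
        using p by (simp add: L.minus_eq L.l_distr L.r_distr L.r_minus L.m_assoc del: One_nat_def)
    qed
    also have "\<dots> = (\<Oplus>\<^bsub>L\<^esub>i\<in>{1..n}. e i \<otimes>\<^bsub>L\<^esub> e' i)"
      unfolding S_def by (rule split[symmetric]) auto
    finally show ?thesis
      using fam by (simp add: leavitt_family_def)
  qed
  ultimately have "leavitt_family L n \<epsilon> \<gamma>"
    using closed by (simp add: leavitt_family_def)
  then obtain h where h: "h \<in> algebra_hom R L L"
    "\<And>i. i \<in> {1..n} \<Longrightarrow> h (e i) = \<epsilon> i" "\<And>i. i \<in> {1..n} \<Longrightarrow> h (e' i) = \<gamma> i"
    using rose_LPA_lift[OF L.assoc_algebra_axioms] unfolding L_def e_def e'_def by metis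
  \<comment> \<open>\<open>h\<close> is compared with the identity on the generators of the
    subalgebra. The generators left out are exactly the edge and the ghost edge at which
    \<open>\<epsilon>\<close> and \<open>\<gamma>\<close> differ from \<open>e\<close> and
    \<open>e'\<close>.\<close>
  have "h q = q" if "q \<in> rose_subalgebra R n 1 2" for q
  proof (rule algebra_hom_eq_on_generated[OF L.assoc_algebra_axioms L.assoc_algebra_axioms h(1)
        algebra_hom_id])
    let ?S = "rose_elem R n ` ({Vertex} \<union> Edge ` ({1..n} - {2}) \<union> Ghost ` ({1..n} - {1}))"
    show "?S \<subseteq> carrier L"
      unfolding L_def by (auto intro!: rose_elem_closed simp: rose_gens_def)
    show "h s = s" if "s \<in> ?S" for s
      using that h(2,3) algebra_hom_one[OF h(1)] rose_LPA_relations(1)[of n]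
      by (auto simp: e_def e'_def \<epsilon>_def \<gamma>_def L_def split: if_splits)
    show "q \<in> subalgebra_generated R L ?S"
      using that by (simp add: rose_subalgebra_def L_def)
  qed
  then show ?thesis
    using that[OF h(1)] h(2)[of 2] h(3)[of 1] n by (simp add: \<epsilon>_def \<gamma>_def)
qed

end

section \<open>From endomorphisms to automorphisms\<close>

lemma (in assoc_algebra) subalgebra_generated_closed:
  assumes "S \<subseteq> carrier M"
  shows "subalgebra_generated R M S \<subseteq> carrier M"
  using assms carrier_is_submodule M.carrier_is_subring
  by (auto simp: subalgebra_generated_def)

lemma (in cring) rose_subalgebra_closed: "rose_subalgebra R n s t \<subseteq> carrier (rose_LPA R n)"
  unfolding rose_subalgebra_def
  by (intro assoc_algebra.subalgebra_generated_closed rose_LPA_assoc_algebra)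
     (auto intro!: rose_elem_closed simp: rose_gens_def)

lemma algebra_auto_imp_algebra_hom: "\<sigma> \<in> algebra_auto K L \<Longrightarrow> \<sigma> \<in> algebra_hom K L L"
  by (simp add: algebra_auto_def algebra_hom_def)

text \<open>Restriction makes \<open>h\<close> extensional, as \<open>Bij\<close> demands, and keeps
  its values on the carrier.\<close>

lemma algebra_auto_restrictI:
  assumes "ring L" "module K L" and h: "h \<in> algebra_hom K L L" "bij_betw h (carrier L) (carrier L)"
  shows "restrict h (carrier L) \<in> algebra_auto K L"
proof -
  interpret L: ring L by fact
  interpret module K L by fact
  have "restrict h (carrier L) \<in> ring_hom L L"
    using algebra_hom_closed[OF h(1)] algebra_hom_mult[OF h(1)] algebra_hom_add[OF h(1)]
      algebra_hom_one[OF h(1)]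
    by (intro ring_hom_memI) simp_all
  then show ?thesis
    using h(2) algebra_hom_smult[OF h(1)] by (auto simp: algebra_auto_def Bij_def)
qed

theorem corollary2p8:
  fixes K :: "('k, 'm) ring_scheme" and n :: nat
    and L :: "('k, (rose_gen list \<Rightarrow> 'k) set) module" (structure)
    and A :: "(rose_gen list \<Rightarrow> 'k) set set"
    and e e' :: "nat \<Rightarrow> (rose_gen list \<Rightarrow> 'k) set"
  assumes "field K" and "n \<ge> 2"
    and "L = rose_LPA K n"
    and "A = rose_subalgebra K n 1 2"
    and "\<And>i. e i = rose_elem K n (Edge i)"
    and "\<And>i. e' i = rose_elem K n (Ghost i)"
    and "p \<in> A"
  shows "\<exists>!\<sigma>. \<sigma> \<in> algebra_auto K L
     \<and> \<sigma> (e 2) = e 2 \<oplus> e 1 \<otimes> p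
     \<and> \<sigma> (e' 1) = e' 1 \<ominus> p \<otimes> e' 2
     \<and> inv_into (carrier L) \<sigma> (e 2) = e 2 \<ominus> e 1 \<otimes> p
     \<and> inv_into (carrier L) \<sigma> (e' 1) = e' 1 \<oplus> p \<otimes> e' 2
     \<and> (\<forall>q\<in>A. \<sigma> q = q)"
proof -
  interpret K: field K by fact
  interpret L: assoc_algebra K L
    unfolding assms(3) by (rule K.rose_LPA_assoc_algebra)
  have pL: "p \<in> carrier L"
    using assms(3,4,7) K.rose_subalgebra_closed by blast
  have e: "e i \<in> carrier L" "e' i \<in> carrier L" if "i \<in> {1..n}" for i
    using that by (auto simp: assms(3,5,6) rose_gens_def intro!: K.rose_elem_closed)
  have e12: "e 1 \<in> carrier L" "e 2 \<in> carrier L" "e' 1 \<in> carrier L" "e' 2 \<in> carrier L"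
    using e assms(2) by simp_all
  have in_A: "rose_elem K n ` ({Vertex} \<union> Edge ` ({1..n} - {2}) \<union> Ghost ` ({1..n} - {1})) \<subseteq> A"
    by (auto simp: assms(4) rose_subalgebra_def subalgebra_generated_def)
  have e_A: "e i \<in> A" if "i \<in> {1..n}" "i \<noteq> 2" for i
    using in_A that by (auto simp: assms(5))
  have e'_A: "e' i \<in> A" if "i \<in> {1..n}" "i \<noteq> 1" for i
    using in_A that by (auto simp: assms(6))
  \<comment> \<open>All edges except \<open>e 2\<close> and all ghost edges except
    \<open>e' 1\<close> lie in \<open>A\<close>, so the listed values cover every generator.\<close>
  have hom_eqI: "g x = h x"
    if "g \<in> algebra_hom K L L" "h \<in> algebra_hom K L L" "g (e 2) = h (e 2)" "g (e' 1) = h (e' 1)"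
      "\<And>q. q \<in> A \<Longrightarrow> g q = h q" "x \<in> carrier L" for g h x
  proof (rule K.rose_LPA_hom_eqI[OF L.assoc_algebra_axioms, where g = g and h = h and x = x and n = n])
    show "g \<in> algebra_hom K (rose_LPA K n) L" "h \<in> algebra_hom K (rose_LPA K n) L"
      "x \<in> carrier (rose_LPA K n)"
      using that assms(3) by simp_all
    show "g (rose_elem K n (Edge i)) = h (rose_elem K n (Edge i))" if "i \<in> {1..n}" for i
      using \<open>g (e 2) = h (e 2)\<close> \<open>\<And>q. q \<in> A \<Longrightarrow> g q = h q\<close> e_A that
      by (cases "i = 2") (simp_all flip: assms(5))
    show "g (rose_elem K n (Ghost i)) = h (rose_elem K n (Ghost i))" if "i \<in> {1..n}" for i
      using \<open>g (e' 1) = h (e' 1)\<close> \<open>\<And>q. q \<in> A \<Longrightarrow> g q = h q\<close> e'_A that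
      by (cases "i = 1") (simp_all flip: assms(6))
  qed
  have twist: "\<exists>h. h \<in> algebra_hom K L L \<and> h (e 2) = e 2 \<oplus> e 1 \<otimes> q
      \<and> h (e' 1) = e' 1 \<ominus> q \<otimes> e' 2 \<and> (\<forall>q\<in>A. h q = q)" if q: "q \<in> carrier L" for q
  proof (rule K.rose_LPA_twist[OF assms(2) q[unfolded assms(3)]])
    fix h
    assume "h \<in> algebra_hom K (rose_LPA K n) (rose_LPA K n)"
      "h (rose_elem K n (Edge 2)) = rose_elem K n (Edge 2)
        \<oplus>\<^bsub>rose_LPA K n\<^esub> rose_elem K n (Edge 1) \<otimes>\<^bsub>rose_LPA K n\<^esub> q"
      "h (rose_elem K n (Ghost 1)) = rose_elem K n (Ghost 1)
        \<ominus>\<^bsub>rose_LPA K n\<^esub> q \<otimes>\<^bsub>rose_LPA K n\<^esub> rose_elem K n (Ghost 2)"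
      "\<And>r. r \<in> rose_subalgebra K n 1 2 \<Longrightarrow> h r = r"
    then show ?thesis
      unfolding assms(3-6) by (intro exI[of _ h] conjI ballI)
  qed
  obtain h where h: "h \<in> algebra_hom K L L" "h (e 2) = e 2 \<oplus> e 1 \<otimes> p"
    "h (e' 1) = e' 1 \<ominus> p \<otimes> e' 2" "\<And>q. q \<in> A \<Longrightarrow> h q = q"
    using twist[OF pL] by auto
  \<comment> \<open>The twist by \<open>\<ominus> p\<close> is the candidate for the
    inverse.\<close>
  obtain g where g: "g \<in> algebra_hom K L L" "g (e 2) = e 2 \<oplus> e 1 \<otimes> (\<ominus> p)"
    "g (e' 1) = e' 1 \<ominus> (\<ominus> p) \<otimes> e' 2" "\<And>q. q \<in> A \<Longrightarrow> g q = q"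
    using twist[OF L.M.a_inv_closed[OF pL]] by auto
  have g_e: "g (e 2) = e 2 \<ominus> e 1 \<otimes> p" "g (e' 1) = e' 1 \<oplus> p \<otimes> e' 2"
    unfolding g(2,3) using e12 pL
    by (simp_all add: L.minus_eq L.l_minus L.r_minus del: One_nat_def)
  interpret h: ring_hom_ring L L h
    by (rule algebra_hom_ring_hom_ring[OF L.assoc_algebra_axioms L.assoc_algebra_axioms h(1)])
  interpret g: ring_hom_ring L L g
    by (rule algebra_hom_ring_hom_ring[OF L.assoc_algebra_axioms L.assoc_algebra_axioms g(1)])
  have A12: "e 1 \<in> A" "e' 2 \<in> A"
    using e_A e'_A assms(2) by simp_all
  \<comment> \<open>Here \<open>p \<in> A\<close> enters: together with \<open>e 1\<close> and
    \<open>e' 2\<close>, also \<open>p\<close> is fixed by both maps, so the correction terms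
    \<open>e 1 \<otimes> p\<close> and \<open>p \<otimes> e' 2\<close> are unchanged by
    them.\<close>
  note fixed = h(4)[OF A12(1)] h(4)[OF A12(2)] h(4)[OF assms(7)]
    g(4)[OF A12(1)] g(4)[OF A12(2)] g(4)[OF assms(7)]
  have cancel: "a \<oplus> b \<ominus> b = a" "a \<ominus> b \<oplus> b = a" if "a \<in> carrier L" "b \<in> carrier L" for a b
    using that by (simp_all add: L.minus_eq L.a_assoc L.l_neg L.r_neg)
  \<comment> \<open>For instance, \<open>h\<close> sends \<open>e 2 - e 1 p\<close> to
    \<open>(e 2 + e 1 p) - e 1 p\<close>, which is \<open>e 2\<close>.\<close>
  have hg: "h (g (e 2)) = e 2" "h (g (e' 1)) = e' 1" "g (h (e 2)) = e 2" "g (h (e' 1)) = e' 1"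
    using e12 pL by (simp_all add: h(2,3) g_e h.hom_minus g.hom_minus fixed cancel del: One_nat_def)
  have hg_id: "h (g x) = x" if "x \<in> carrier L" for x
  proof -
    have "(h \<circ> g) x = x"
      by (rule hom_eqI[OF algebra_hom_comp[OF h(1) g(1)] algebra_hom_id _ _ _ that])
         (simp_all only: comp_def hg h(4) g(4))
    then show ?thesis
      by simp
  qed
  have gh_id: "g (h x) = x" if "x \<in> carrier L" for x
  proof -
    have "(g \<circ> h) x = x"
      by (rule hom_eqI[OF algebra_hom_comp[OF g(1) h(1)] algebra_hom_id _ _ _ that])
         (simp_all only: comp_def hg h(4) g(4))
    then show ?thesis
      by simp
  qed
  have bij: "bij_betw h (carrier L) (carrier L)"
    by (rule bij_betw_byWitness[of _ g]) (auto simp: hg_id gh_id)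
  define \<sigma> where "\<sigma> = restrict h (carrier L)"
  \<comment> \<open>\<open>inv_into\<close> picks some preimage in the carrier. By injectivity it is
    \<open>g x\<close>, because \<open>h (g x) = x\<close>.\<close>
  have inv: "inv_into (carrier L) \<sigma> x = g x" if "x \<in> carrier L" for x
    using bij that by (intro inv_into_f_eq) (auto simp: \<sigma>_def bij_betw_def hg_id)
  have A_carrier: "A \<subseteq> carrier L"
    unfolding assms(3,4) by (rule K.rose_subalgebra_closed)
  have \<sigma>: "\<sigma> x = h x" if "x \<in> carrier L" for x
    using that by (simp add: \<sigma>_def)
  show ?thesis
  proof (rule ex1I[of _ \<sigma>], intro conjI ballI)
    show "\<sigma> \<in> algebra_auto K L"
      unfolding \<sigma>_def
      by (rule algebra_auto_restrictI[OF L.M.ring_axioms L.module_axioms h(1) bij])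
    show "\<sigma> (e 2) = e 2 \<oplus> e 1 \<otimes> p" "\<sigma> (e' 1) = e' 1 \<ominus> p \<otimes> e' 2"
      unfolding \<sigma>[OF e12(2)] \<sigma>[OF e12(3)] by (rule h(2) h(3))+
    show "inv_into (carrier L) \<sigma> (e 2) = e 2 \<ominus> e 1 \<otimes> p"
      "inv_into (carrier L) \<sigma> (e' 1) = e' 1 \<oplus> p \<otimes> e' 2"
      unfolding inv[OF e12(2)] inv[OF e12(3)] by (rule g_e)+
    show "\<sigma> q = q" if "q \<in> A" for q
      using \<sigma> h(4)[OF that] A_carrier that by auto
  next
    fix \<tau>
    assume \<tau>: "\<tau> \<in> algebra_auto K L \<and> \<tau> (e 2) = e 2 \<oplus> e 1 \<otimes> p \<and> \<tau> (e' 1) = e' 1 \<ominus> p \<otimes> e' 2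
      \<and> inv_into (carrier L) \<tau> (e 2) = e 2 \<ominus> e 1 \<otimes> p
      \<and> inv_into (carrier L) \<tau> (e' 1) = e' 1 \<oplus> p \<otimes> e' 2 \<and> (\<forall>q\<in>A. \<tau> q = q)"
    then have \<tau>_eq: "\<tau> (e 2) = h (e 2)" "\<tau> (e' 1) = h (e' 1)" "\<And>q. q \<in> A \<Longrightarrow> \<tau> q = h q"
      by (simp_all only: h(2,3,4))
    show "\<tau> = \<sigma>"
    \<comment> \<open>\<open>hom_eqI\<close> compares the maps on the carrier only; outside it both
      are \<open>undefined\<close> by extensionality.\<close>
    proof (rule extensionalityI[of _ "carrier L"])
      show "\<tau> \<in> extensional (carrier L)"
        using \<tau> by (auto simp: algebra_auto_def Bij_def)
      show "\<tau> x = \<sigma> x" if "x \<in> carrier L" for x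
        unfolding \<sigma>[OF that]
        by (rule hom_eqI[OF algebra_auto_imp_algebra_hom[OF conjunct1[OF \<tau>]] h(1) \<tau>_eq that])
    qed (simp add: \<sigma>_def)
  qed
qed

end
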